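(* For every two fixed integers $r\geq k\geq 2$ the inequality $$ f(n,k,r) \leq \frac{\binom{n}{k}}{\binom{r}{k}}\cdot \frac{r}{n}+ o(n^{k-1})$$ holds as $n\to\infty$.
   Context: A $k$-partition of a finite set $X$ is a partition $\mathcal{P}=(X_1,\dots,X_k)$ of $X$ into precisely $k$ nonempty classes. An $r$-element set $H\subseteq X$ crosses $\mathcal{P}$ if $H$ intersects exactly $\min(r,k)$ of the classes. A hypergraph (set of subsets of $X$) crosses $\mathcal{P}$ if at least one of its members does. For integers $n\ge k$, $n\ge r$, $f(n,k,r)$ denotes the minimum number of edges of an $r$-uniform hypergraph $\mathcal{H}\subseteq\binom{X}{r}$ on an $n$-element set $X$ that crosses every $k$-partition of $X$. *)

theory Defs
  imports Complex_Main "HOL-Library.Disjoint_Sets" "HOL-Library.Landau_Symbols"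
begin

text \<open>The classes are treated as an unlabelled family; \<^const>\<open>partition_on\<close>
  already excludes empty classes. Crossing does not depend on the order of the classes.\<close>

definition k_partition :: "nat \<Rightarrow> 'a set \<Rightarrow> 'a set set \<Rightarrow> bool" where
  "k_partition k X P \<longleftrightarrow> partition_on X P \<and> finite P \<and> card P = k"

definition set_crosses :: "'a set \<Rightarrow> 'a set set \<Rightarrow> bool" where
  "set_crosses H P \<longleftrightarrow> card {A \<in> P. H \<inter> A \<noteq> {}} = min (card H) (card P)"

definition hypergraph_crosses :: "'a set set \<Rightarrow> 'a set set \<Rightarrow> bool" where
  "hypergraph_crosses E P \<longleftrightarrow> (\<exists>H\<in>E. set_crosses H P)"

definition uniform_hypergraph :: "nat \<Rightarrow> 'a set \<Rightarrow> 'a set set \<Rightarrow> bool" where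
  "uniform_hypergraph r X E \<longleftrightarrow> E \<subseteq> {H. H \<subseteq> X \<and> card H = r}"

definition crossing_hypergraph :: "nat \<Rightarrow> nat \<Rightarrow> 'a set \<Rightarrow> 'a set set \<Rightarrow> bool" where
  "crossing_hypergraph k r X E \<longleftrightarrow>
     uniform_hypergraph r X E \<and> (\<forall>P. k_partition k X P \<longrightarrow> hypergraph_crosses E P)"

text \<open>Meaningful for \<open>k \<le> n\<close> and \<open>r \<le> n\<close>, where the complete \<open>r\<close>-uniform hypergraph
  shows that such an \<open>E\<close> exists. The choice of the \<open>n\<close>-element ground set is immaterial.\<close>

definition min_crossing_edges :: "nat \<Rightarrow> nat \<Rightarrow> nat \<Rightarrow> nat" where
  "min_crossing_edges n k r = (LEAST m. \<exists>E. crossing_hypergraph k r {..<n} E \<and> card E = m)"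

end

theory Submission
  imports Defs "HOL-Library.Ramsey" "HOL-Computational_Algebra.Polynomial" "HOL-Real_Asymp.Real_Asymp"
begin

text \<open>
  Put \<open>t = k - 1\<close> and \<open>b = r - 1\<close>, and single out one point \<open>x\<close> of the ground set. If a family of
  \<open>b\<close>-sets covers all \<open>t\<close>-sets of the other \<open>n - 1\<close> points, then adding \<open>x\<close> to each member gives a
  crossing hypergraph: choose a representative in each of the \<open>t\<close> classes that do not contain \<open>x\<close>;
  a member that covers these representatives meets, together with \<open>x\<close>, every class
  (\<open>cone_over_covering_crosses\<close>). By absorption the main term of the bound is
  \<open>(n - 1 choose t) / (b choose t)\<close>, so it suffices to prove the theorem of Roedl (the
  Erdos-Hanani conjecture) that coverings with \<open>(1 + o(1)) (n choose t) / (b choose t)\<close> blocks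
  exist. Such a covering arises from a packing, a family of \<open>b\<close>-sets pairwise meeting in fewer than
  \<open>t\<close> points, that covers almost all \<open>t\<close>-sets: spend one further block on each remaining \<open>t\<close>-set.

  Instead of a nibble, the proof of Roedl's theorem (\<open>packing_ratio_tendsto\<close>) is a single
  self-improvement step. Let \<open>D m\<close> be the maximal size of a packing on \<open>m\<close> points, and let \<open>\<delta>\<close> be the
  fraction of \<open>t\<close>-sets that an optimal packing on \<open>m\<close> points leaves uncovered. The graphs of
  polynomials of degree below \<open>t\<close> modulo \<open>N\<close>, for \<open>N\<close> coprime to \<open>m!\<close>, restricted to \<open>m\<close> arguments,
  are \<open>N ^ t\<close> sets of size \<open>m\<close> among \<open>m N\<close> points, any two meeting in fewer than \<open>t\<close> points
  (\<open>polynomial_code_packing\<close>). Placing an optimal packing inside each of them already gives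
  \<open>D (m N) \<ge> N ^ t * D m\<close>, so that \<open>D n / n ^ t\<close> converges to its supremum. Now place the copies
  independently and uniformly at random. A typical \<open>b\<close>-set has its \<open>t\<close>-subsets in distinct graphs, so
  all \<open>s = (b choose t)\<close> of them are uncovered with probability at least \<open>\<delta> ^ s\<close>
  (\<open>random_packings_leave_uncovered\<close>). Hence for some placement a positive fraction of all \<open>b\<close>-sets,
  depending only on \<open>\<delta>\<close>, \<open>b\<close> and \<open>t\<close>, is compatible with the copies; a maximal packing among these has
  size of order \<open>(m N) ^ t\<close> (\<open>maximal_packing\<close>) and can be added. So \<open>D n / n ^ t\<close> eventually exceeds
  \<open>D m / m ^ t\<close> by nearly a constant multiple of \<open>\<delta> ^ s\<close>, and at the supremum this is only possible
  if \<open>\<delta>\<close> tends to \<open>0\<close>.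
\<close>

section \<open>Packings and the sets they cover\<close>

lemma binomial_le_power: "n choose k \<le> n ^ k"
  by (cases "k \<le> n") (simp_all add: binomial_le_pow binomial_eq_0)

lemma card_nsets:
  assumes "finite V"
  shows "card (nsets V b) = card V choose b"
proof -
  have "nsets V b = {N. N \<subseteq> V \<and> card N = b}"
    using assms by (auto simp: nsets_def intro: finite_subset)
  then show ?thesis using n_subsets[OF assms] by simp
qed

text \<open>The exact count is \<open>(card V - t) choose (b - t)\<close>; a bound of the right order of magnitude is
  enough, since it only affects the size of the constant gained in the improvement step.\<close>

lemma card_nsets_superset_le:
  assumes "finite V" "card T = t" 
  shows "card {K \<in> nsets V b. T \<subseteq> K} \<le> card V ^ (b - t)"
proof (cases "finite T")
  case True
  have "card {K \<in> nsets V b. T \<subseteq> K} \<le> card (nsets V (b - t))"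
  proof (rule card_inj_on_le)
    show "inj_on (\<lambda>K. K - T) {K \<in> nsets V b. T \<subseteq> K}"
      by (auto simp: inj_on_def)
    show "(\<lambda>K. K - T) ` {K \<in> nsets V b. T \<subseteq> K} \<subseteq> nsets V (b - t)"
      using assms True by (auto simp: nsets_def card_Diff_subset)
    show "finite (nsets V (b - t))"
      using assms by (simp add: finite_imp_finite_nsets)
  qed
  also have "\<dots> = card V choose (b - t)"
    using assms by (simp add: card_nsets)
  also have "\<dots> \<le> card V ^ (b - t)"
    by (rule binomial_le_power)
  finally show ?thesis .
next
  case False
  then have "{K \<in> nsets V b. T \<subseteq> K} = {}"
    using finite_subset by (auto simp: nsets_def)
  then have "card {K \<in> nsets V b. T \<subseteq> K} = 0" by (simp only: card.empty)
  then show ?thesis by linarith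
qed

text \<open>Partial Steiner systems: every \<open>t\<close>-subset of \<open>V\<close> lies in at most one block.\<close>

definition packing :: "nat \<Rightarrow> nat \<Rightarrow> 'a set \<Rightarrow> 'a set set \<Rightarrow> bool" where
  "packing t b V P \<longleftrightarrow>
     P \<subseteq> nsets V b \<and> (\<forall>X\<in>P. \<forall>Y\<in>P. X \<noteq> Y \<longrightarrow> card (X \<inter> Y) < t)"

definition shadow :: "nat \<Rightarrow> 'a set set \<Rightarrow> 'a set set" where
  "shadow t P = (\<Union>X\<in>P. nsets X t)"

lemma packing_finite: "finite V \<Longrightarrow> packing t b V P \<Longrightarrow> finite P"
  using finite_subset[of P "nsets V b"] finite_imp_finite_nsets[of V b]
  unfolding packing_def by simp

lemma packing_mono: "packing t b V P \<Longrightarrow> V \<subseteq> W \<Longrightarrow> packing t b W P"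
  unfolding packing_def using nsets_mono[of V W b] by (meson order_trans)

lemma packing_image:
  assumes "inj_on f V" "packing t b V P"
  shows "packing t b (f ` V) ((`) f ` P)" "card ((`) f ` P) = card P"
proof -
  have sub: "\<And>X. X \<in> P \<Longrightarrow> X \<subseteq> V \<and> finite X \<and> card X = b"
    using assms(2) by (auto simp: packing_def nsets_def)
  have "card (f ` X \<inter> f ` Y) < t" if "X \<in> P" "Y \<in> P" "f ` X \<noteq> f ` Y" for X Y
  proof -
    have "f ` X \<inter> f ` Y = f ` (X \<inter> Y)"
      using inj_on_image_Int[OF assms(1), of X Y] sub that by simp
    moreover have "card (f ` (X \<inter> Y)) = card (X \<inter> Y)"
      using sub[OF that(1)] by (intro card_image inj_on_subset[OF assms(1)]) auto
    moreover have "X \<noteq> Y" using that by blast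
    then have "card (X \<inter> Y) < t"
      using that assms(2) unfolding packing_def by blast
    ultimately show ?thesis by simp
  qed
  moreover have "f ` X \<in> nsets (f ` V) b" if "X \<in> P" for X
    using sub[OF that] inj_on_subset[OF assms(1), of X] by (auto simp: nsets_def card_image)
  ultimately show "packing t b (f ` V) ((`) f ` P)"
    unfolding packing_def by blast
  have "inj_on ((`) f) P"
    using sub by (intro inj_onI) (simp add: inj_on_image_eq_iff[OF assms(1)])
  then show "card ((`) f ` P) = card P" by (rule card_image)
qed

text \<open>Distinct blocks share no \<open>t\<close>-set, so nothing is counted twice.\<close>

lemma card_shadow:
  assumes "finite V" "packing t b V P"
  shows "card (shadow t P) = card P * (b choose t)"
proof -
  have X: "finite X \<and> card X = b" if "X \<in> P" for X
    using assms that by (auto simp: packing_def nsets_def)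
  have "nsets X t \<inter> nsets Y t = {}" if "X \<in> P" "Y \<in> P" "X \<noteq> Y" for X Y
  proof -
    have "card (X \<inter> Y) < t" using assms that by (auto simp: packing_def)
    moreover have "card T \<le> card (X \<inter> Y)" if "T \<subseteq> X" "T \<subseteq> Y" for T
      using that X[OF \<open>X \<in> P\<close>] by (intro card_mono) auto
    ultimately have False if "T \<in> nsets X t" "T \<in> nsets Y t" for T
      using that by (simp add: nsets_def) (metis leD)
    then show ?thesis by blast
  qed
  then have "card (shadow t P) = (\<Sum>X\<in>P. card (nsets X t))"
    unfolding shadow_def using X packing_finite[OF assms]
    by (intro card_UN_disjoint ballI impI) (simp_all add: finite_imp_finite_nsets)
  also have "\<dots> = (\<Sum>X\<in>P. b choose t)"
    using X by (intro sum.cong) (auto simp: card_nsets)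
  finally show ?thesis by simp
qed

lemma shadow_subset:
  assumes "packing t b V P"
  shows "shadow t P \<subseteq> nsets V t"
  unfolding shadow_def
proof (intro UN_least nsets_mono)
  fix X assume "X \<in> P"
  then have "X \<in> nsets V b" using assms by (auto simp: packing_def)
  then show "X \<subseteq> V" by (simp add: nsets_def)
qed

lemma packing_card_le:
  assumes "finite V" "packing t b V P"
  shows "card P * (b choose t) \<le> card V choose t"
  using card_mono[OF finite_imp_finite_nsets[OF assms(1)] shadow_subset[OF assms(2)]]
  by (simp add: card_shadow[OF assms] card_nsets assms(1))

definition packing_number :: "nat \<Rightarrow> nat \<Rightarrow> nat \<Rightarrow> nat" where
  "packing_number t b n = Max {card P |P. packing t b {..<n} P}"

lemma packing_number_witness: "\<exists>P. packing t b {..<n} P \<and> card P = packing_number t b n"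
  and packing_number_ge: "packing t b {..<n} P \<Longrightarrow> card P \<le> packing_number t b n"
proof -
  let ?S = "{card P |P. packing t b {..<n} P}"
  have "?S \<subseteq> card ` Pow (nsets {..<n} b)"
    by (auto simp: packing_def)
  then have fin: "finite ?S"
    by (rule finite_subset) (simp add: finite_imp_finite_nsets)
  have "packing t b {..<n} {}" by (simp add: packing_def)
  then have "?S \<noteq> {}" by blast
  with fin have "packing_number t b n \<in> ?S"
    unfolding packing_number_def by (rule Max_in)
  then obtain Q where "packing_number t b n = card Q" "packing t b {..<n} Q"
    by blast
  then show "\<exists>P. packing t b {..<n} P \<and> card P = packing_number t b n"
    by (intro exI[of _ Q]) simp
  show "card P \<le> packing_number t b n" if "packing t b {..<n} P"
  proof -
    from that have "card P \<in> ?S" by blast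
    then show ?thesis unfolding packing_number_def by (rule Max_ge[OF fin])
  qed
qed

text \<open>Only the size of the ground set matters: an injection into \<open>{..<n}\<close> carries packings to packings.\<close>

lemma packing_number_ge_card:
  assumes "finite V" "card V \<le> n" "packing t b V P"
  shows "card P \<le> packing_number t b n"
proof -
  obtain f where f: "f ` V \<subseteq> {..<n}" "inj_on f V"
    using card_le_inj[OF assms(1) finite_lessThan] assms(2) by (metis card_lessThan)
  have "packing t b {..<n} ((`) f ` P)"
    using packing_mono[OF packing_image(1)[OF f(2) assms(3)] f(1)] .
  from packing_number_ge[OF this] show ?thesis
    by (simp add: packing_image(2)[OF f(2) assms(3)])
qed

lemma packing_number_le: "packing_number t b n * (b choose t) \<le> n choose t"
proof -
  obtain P where "packing t b {..<n} P" "card P = packing_number t b n"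
    using packing_number_witness by blast
  then show ?thesis using packing_card_le[of "{..<n}" t b P] by simp
qed

section \<open>Random packings inside the blocks of a coarser packing\<close>

text \<open>A permutation of \<open>B\<close> that maps \<open>T\<close> onto \<open>T'\<close> maps the packings that avoid \<open>T\<close> injectively to
  packings that avoid \<open>T'\<close>. By symmetry the two counts are therefore equal.\<close>

lemma card_packings_avoiding_le:
  assumes "finite B" "T \<in> nsets B t" "T' \<in> nsets B t"
  shows "card {P. (packing t b B P \<and> card P = D) \<and> T \<notin> shadow t P}
       \<le> card {P. (packing t b B P \<and> card P = D) \<and> T' \<notin> shadow t P}" (is "card ?L \<le> card ?R")
proof -
  have T: "T \<subseteq> B" "T' \<subseteq> B" "finite T" "finite T'" "card T = t" "card T' = t"
    using assms by (auto simp: nsets_def)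
  then have "card (B - T) = card (B - T')"
    by (simp add: card_Diff_subset)
  then obtain g where g: "bij_betw g (B - T) (B - T')"
    using finite_same_card_bij[of "B - T" "B - T'"] assms(1) by auto
  obtain h where h: "bij_betw h T T'"
    using finite_same_card_bij[of T T'] T by auto
  define f where "f = (\<lambda>x. if x \<in> T then h x else g x)"
  have "bij_betw f (T \<union> (B - T)) (T' \<union> (B - T'))"
    unfolding f_def by (rule bij_betw_disjoint_Un[OF h g]) auto
  moreover have "T \<union> (B - T) = B" "T' \<union> (B - T') = B" using T by auto
  ultimately have f: "inj_on f B" "f ` B = B"
    by (auto simp: bij_betw_def)
  have fT: "f ` T = T'"
    using h by (auto simp: f_def bij_betw_def)
  have sub: "X \<subseteq> B" if "packing t b B P" "X \<in> P" for P X
    using that by (auto simp: packing_def nsets_def)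
  then have Pow: "P \<in> Pow (Pow B)" if "packing t b B P" for P
    using that by blast
  show ?thesis
  proof (rule card_inj_on_le)
    have "inj_on ((`) ((`) f)) (Pow (Pow B))"
      by (intro inj_on_image_Pow f)
    moreover have "?L \<subseteq> Pow (Pow B)" by (intro subsetI Pow) simp
    ultimately show "inj_on ((`) ((`) f)) ?L" by (rule inj_on_subset)
    show "((`) ((`) f)) ` ?L \<subseteq> ?R"
    proof
      fix Q assume "Q \<in> ((`) ((`) f)) ` ?L"
      then obtain P where P: "packing t b B P" "card P = D" "T \<notin> shadow t P" "Q = (`) f ` P"
        by blast
      have "T' \<notin> shadow t Q"
      proof
        assume "T' \<in> shadow t Q"
        then obtain X where X: "X \<in> P" "f ` T \<subseteq> f ` X"
          using P(4) fT by (auto simp: shadow_def nsets_def)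
        have "T \<subseteq> X"
        proof
          fix x assume "x \<in> T"
          then show "x \<in> X"
            using X(2) T(1) inj_on_image_mem_iff[OF f(1) _ sub[OF P(1) X(1)], of x] by blast
        qed
        with T X(1) have "T \<in> shadow t P"
          by (auto simp: shadow_def nsets_def)
        with P(3) show False by simp
      qed
      then show "Q \<in> ?R"
        using packing_image[OF f(1) P(1)] P f(2) by simp
    qed
    have "?R \<subseteq> Pow (Pow B)" by (intro subsetI Pow) simp
    then show "finite ?R" by (rule finite_subset) (simp add: assms)
  qed
qed

text \<open>In a uniformly random packing with \<open>D\<close> blocks each \<open>t\<close>-set is thus uncovered with the same
  probability. Double counting identifies it as the fraction of \<open>t\<close>-sets that any one such packing
  leaves uncovered.\<close>

lemma card_packings_avoiding:
  assumes "finite B" "T \<in> nsets B t"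
  shows "card {P. (packing t b B P \<and> card P = D) \<and> T \<notin> shadow t P} * (card B choose t)
       = card {P. packing t b B P \<and> card P = D} * ((card B choose t) - D * (b choose t))"
proof -
  let ?Ps = "{P. packing t b B P \<and> card P = D}"
  let ?N = "\<lambda>T. card {P \<in> ?Ps. T \<notin> shadow t P}"
  have N: "?N T' = ?N T" if "T' \<in> nsets B t" for T'
    using card_packings_avoiding_le[OF assms(1) that assms(2), of b D]
      card_packings_avoiding_le[OF assms(1) assms(2) that, of b D]
    by simp
  have finN: "finite (nsets B t)" using assms by (simp add: finite_imp_finite_nsets)
  have "?Ps \<subseteq> Pow (nsets B b)" by (auto simp: packing_def)
  then have finP: "finite ?Ps"
    by (rule finite_subset) (simp add: assms finite_imp_finite_nsets)
  have avoid: "card {T' \<in> nsets B t. T' \<notin> shadow t P} = (card B choose t) - D * (b choose t)"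
    if "P \<in> ?Ps" for P
  proof -
    have "{T' \<in> nsets B t. T' \<notin> shadow t P} = nsets B t - shadow t P" by auto
    moreover have "shadow t P \<subseteq> nsets B t" using shadow_subset that by blast
    moreover have "card (shadow t P) = D * (b choose t)"
      using card_shadow[OF assms(1)] that by blast
    ultimately show ?thesis
      using finN by (simp add: card_Diff_subset finite_subset card_nsets assms(1))
  qed
  have "(\<Sum>T'\<in>nsets B t. ?N T') = (\<Sum>P\<in>?Ps. (card B choose t) - D * (b choose t))"
    using finN finP avoid by (intro sum_multicount_gen) auto
  moreover have "(\<Sum>T'\<in>nsets B t. ?N T') = (\<Sum>T'\<in>nsets B t. ?N T)"
    using N by (intro sum.cong) auto
  ultimately show ?thesis
    by (simp add: card_nsets[OF assms(1)] mult.commute)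
qed

text \<open>Choose the packings \<open>F B\<close> independently and uniformly among those with \<open>D\<close> blocks. A set \<open>K\<close> that
  meets every \<open>B \<in> H\<close> in at most \<open>t\<close> points has at most one \<open>t\<close>-subset inside any \<open>B\<close>, so the events
  that its \<open>t\<close>-subsets are uncovered depend on different choices and multiply. The expected number
  of surviving \<open>K\<close> gives the bound. Probabilities are expressed as counts in the product set \<open>\<Omega>\<close>.\<close>

lemma random_packings_leave_uncovered:
  fixes H :: "'a set set" and m t b D :: nat
  assumes V: "finite V" and H: "packing t m V H" and tm: "t \<le> m"
    and P0: "packing t b {..<m} P0" "card P0 = D"
  defines "s \<equiv> b choose t"
  defines "\<delta> \<equiv> 1 - real (D * s) / real (m choose t)"
  defines "G \<equiv> {K \<in> nsets V b. \<forall>B\<in>H. card (K \<inter> B) \<le> t}"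
  shows "\<exists>F. (\<forall>B\<in>H. packing t b B (F B) \<and> card (F B) = D) \<and>
     \<delta> ^ s * real (card G) \<le>
       real (card {K \<in> G. \<forall>T\<in>nsets K t. \<forall>B\<in>H. T \<notin> shadow t (F B)})"
proof -
  have finH: "finite H" using packing_finite[OF V H] .
  have B: "finite B" "card B = m" "B \<subseteq> V" if "B \<in> H" for B
    using H that by (auto simp: packing_def nsets_def)
  have finG: "finite G"
    unfolding G_def using V by (simp add: finite_imp_finite_nsets)
  have C: "m choose t > 0" using tm by simp
  have Ds: "D * s \<le> m choose t"
    using packing_card_le[OF _ P0(1)] P0(2) by (simp add: s_def)
  then have \<delta>: "0 \<le> \<delta>" "\<delta> \<le> 1"
    unfolding \<delta>_def using C by (auto simp: divide_le_eq of_nat_mult[symmetric] simp del: of_nat_mult)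
  define Ps where "Ps = (\<lambda>B::'a set. {P. packing t b B P \<and> card P = D})"
  have finP: "finite (Ps B)" if "B \<in> H" for B
  proof -
    have "Ps B \<subseteq> Pow (nsets B b)" by (auto simp: packing_def Ps_def)
    then show ?thesis
      by (rule finite_subset) (simp add: B[OF that] finite_imp_finite_nsets)
  qed
  have neP: "Ps B \<noteq> {}" if BH: "B \<in> H" for B
  proof -
    obtain f where f: "bij_betw f {..<m} B"
      using finite_same_card_bij[of "{..<m}" B] B[OF BH] by auto
    then have "packing t b B ((`) f ` P0)" "card ((`) f ` P0) = D"
      using packing_image[of f "{..<m}" t b P0] P0 by (auto simp: bij_betw_def)
    then show ?thesis unfolding Ps_def by blast
  qed
  define \<Omega> where "\<Omega> = PiE H Ps"
  have fin\<Omega>: "finite \<Omega>" unfolding \<Omega>_def using finH finP by (intro finite_PiE)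
  have card\<Omega>: "card \<Omega> = (\<Prod>B\<in>H. card (Ps B))"
    unfolding \<Omega>_def by (rule card_PiE[OF finH])
  have pos\<Omega>: "card \<Omega> > 0"
    unfolding card\<Omega> using finP neP by (intro prod_pos) (simp add: card_gt_0_iff)
  define R where "R = (\<lambda>(F :: 'a set \<Rightarrow> 'a set set) K. \<forall>T\<in>nsets K t. \<forall>B\<in>H. T \<notin> shadow t (F B))"
  have count: "\<delta> ^ s * real (card \<Omega>) \<le> real (card {F \<in> \<Omega>. R F K})" if K: "K \<in> G" for K
  proof -
    have K': "finite K" "card K = b" "\<And>B. B \<in> H \<Longrightarrow> card (K \<inter> B) \<le> t"
      using K by (auto simp: G_def nsets_def)
    define A where "A = (\<lambda>B. {P \<in> Ps B. \<forall>T\<in>nsets K t. T \<notin> shadow t P})"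
    have "{F \<in> \<Omega>. R F K} = PiE H A"
      unfolding \<Omega>_def R_def A_def by (fastforce simp: PiE_iff)
    then have cardA: "card {F \<in> \<Omega>. R F K} = (\<Prod>B\<in>H. card (A B))"
      by (simp add: card_PiE[OF finH])
    have inB: "T \<subseteq> K \<inter> B" if "P \<in> Ps B" "T \<in> nsets K t" "T \<in> shadow t P" for P B T
      using that shadow_subset[of t b B P] by (auto simp: Ps_def nsets_def)
    \<comment> \<open>Only the coordinates in \<open>E\<close> carry a condition, and a condition on exactly one \<open>t\<close>-set.\<close>
    define E where "E = {B \<in> H. card (K \<inter> B) = t}"
    have a: "real (card (A B)) = (if B \<in> E then \<delta> else 1) * real (card (Ps B))" if BH: "B \<in> H" for B
    proof (cases "B \<in> E")
      case True
      then have KB: "card (K \<inter> B) = t" by (simp add: E_def)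
      have "T = K \<inter> B" if "P \<in> Ps B" "T \<in> nsets K t" "T \<in> shadow t P" for P T
        using inB[OF that] that(2) KB K'(1) by (intro card_subset_eq) (auto simp: nsets_def)
      moreover have "K \<inter> B \<in> nsets K t" using K' KB by (simp add: nsets_def)
      ultimately have "A B = {P. (packing t b B P \<and> card P = D) \<and> K \<inter> B \<notin> shadow t P}"
        unfolding A_def Ps_def by blast
      moreover have "K \<inter> B \<in> nsets B t" using K' KB by (simp add: nsets_def)
      ultimately have "card (A B) * (m choose t) = card (Ps B) * ((m choose t) - D * s)"
        using card_packings_avoiding[OF B(1)[OF BH], of "K \<inter> B" t b D] B(2)[OF BH]
        by (simp add: Ps_def s_def)
      then have "real (card (A B)) * real (m choose t) = real (card (Ps B)) * (real (m choose t) - real (D * s))"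
        unfolding of_nat_diff[OF Ds, symmetric] of_nat_mult[symmetric] by (rule arg_cong)
      then show ?thesis
        using True C by (simp add: \<delta>_def field_simps)
    next
      case False
      then have KB: "card (K \<inter> B) < t" using K'(3)[OF BH] BH by (auto simp: E_def)
      have "T \<notin> shadow t P" if "P \<in> Ps B" "T \<in> nsets K t" for P T
      proof
        assume "T \<in> shadow t P"
        then have "card T \<le> card (K \<inter> B)"
          using inB[OF that] K'(1) by (intro card_mono) auto
        with KB that(2) show False by (simp add: nsets_def)
      qed
      then have "A B = Ps B" unfolding A_def by blast
      with False show ?thesis by simp
    qed
    \<comment> \<open>Two members of \<open>H\<close> cannot contain the same \<open>t\<close>-set, so \<open>E\<close> injects into the \<open>t\<close>-subsets of \<open>K\<close>.\<close>
    have "card E \<le> card (nsets K t)"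
    proof (rule card_inj_on_le)
      show "inj_on (\<lambda>B. K \<inter> B) E"
      proof (rule inj_onI, rule ccontr)
        fix B B' assume *: "B \<in> E" "B' \<in> E" "K \<inter> B = K \<inter> B'" "B \<noteq> B'"
        then have "card (K \<inter> B) \<le> card (B \<inter> B')"
          using B(1)[of B] by (intro card_mono) (auto simp: E_def)
        moreover have "card (B \<inter> B') < t"
          using H * by (auto simp: packing_def E_def)
        ultimately show False using * by (simp add: E_def)
      qed
      show "(\<lambda>B. K \<inter> B) ` E \<subseteq> nsets K t"
        using K' by (auto simp: E_def nsets_def)
      show "finite (nsets K t)" using K' by (simp add: finite_imp_finite_nsets)
    qed
    then have cardE: "card E \<le> s" using K' by (simp add: card_nsets s_def)
    have "\<delta> ^ s * real (card \<Omega>) \<le> \<delta> ^ card E * real (card \<Omega>)"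
      using cardE \<delta> by (intro mult_right_mono power_decreasing) auto
    also have "\<delta> ^ card E = (\<Prod>B\<in>H. if B \<in> E then \<delta> else 1)"
    proof -
      have "H \<inter> {B. B \<in> E} = E" by (auto simp: E_def)
      then show ?thesis using finH by (simp add: prod.If_cases)
    qed
    also have "(\<Prod>B\<in>H. if B \<in> E then \<delta> else 1) * real (card \<Omega>)
       = (\<Prod>B\<in>H. (if B \<in> E then \<delta> else 1) * real (card (Ps B)))"
      unfolding card\<Omega> of_nat_prod by (rule prod.distrib[symmetric])
    also have "\<dots> = (\<Prod>B\<in>H. real (card (A B)))"
      using a by (intro prod.cong) auto
    also have "\<dots> = real (card {F \<in> \<Omega>. R F K})"
      unfolding cardA of_nat_prod ..
    finally show ?thesis .
  qed
  have "\<exists>F\<in>\<Omega>. \<delta> ^ s * real (card G) \<le> real (card {K \<in> G. R F K})"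
  proof (rule ccontr)
    assume "\<not> ?thesis"
    then have "(\<Sum>F\<in>\<Omega>. real (card {K \<in> G. R F K})) < (\<Sum>F\<in>\<Omega>. \<delta> ^ s * real (card G))"
      using fin\<Omega> pos\<Omega> by (intro sum_strict_mono) (auto simp: not_le)
    also have "\<dots> = (\<Sum>K\<in>G. \<delta> ^ s * real (card \<Omega>))" by simp
    also have "\<dots> \<le> (\<Sum>K\<in>G. real (card {F \<in> \<Omega>. R F K}))"
      using count by (intro sum_mono)
    also have "\<dots> = real (\<Sum>F\<in>\<Omega>. card {K \<in> G. R F K})"
      using sum_multicount_gen[OF finG fin\<Omega>, of "\<lambda>K F. R F K" "\<lambda>F. card {K \<in> G. R F K}"] by (simp flip: of_nat_sum)
    finally show False by simp
  qed
  then obtain F where F: "F \<in> \<Omega>" "\<delta> ^ s * real (card G) \<le> real (card {K \<in> G. R F K})" by blast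
  moreover have "packing t b B (F B) \<and> card (F B) = D" if "B \<in> H" for B
    using F(1) that by (auto simp: \<Omega>_def Ps_def PiE_iff)
  ultimately show ?thesis unfolding R_def by blast
qed

section \<open>Enlarging a union of packings\<close>

text \<open>By maximality each member of \<open>\<K>\<close> contains a \<open>t\<close>-set covered by \<open>M\<close>, and few \<open>b\<close>-sets contain a given
  \<open>t\<close>-set. So a dense family \<open>\<K>\<close> contains a packing of the largest possible order of magnitude.\<close>

lemma maximal_packing:
  assumes V: "finite V" and \<K>: "\<K> \<subseteq> nsets V b" and tb: "t \<le> b"
  obtains M where "M \<subseteq> \<K>" "packing t b V M"
    "card \<K> \<le> card M * ((b choose t) * card V ^ (b - t))"
proof -
  let ?S = "{M. M \<subseteq> \<K> \<and> packing t b V M}"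
  have fin\<K>: "finite \<K>"
    using \<K> by (rule finite_subset) (simp add: V finite_imp_finite_nsets)
  then have "finite ?S" by (intro finite_subset[of ?S "Pow \<K>"]) auto
  moreover have "{} \<in> ?S" by (simp add: packing_def)
  ultimately have "\<exists>M\<in>?S. \<forall>M'\<in>?S. M \<subseteq> M' \<longrightarrow> M = M'"
    by (intro finite_has_maximal) auto
  then obtain M where "M \<in> ?S" and max: "\<And>M'. M' \<in> ?S \<Longrightarrow> M \<subseteq> M' \<Longrightarrow> M = M'"
    by metis
  then have M: "M \<subseteq> \<K>" "packing t b V M" by simp_all
  have sub: "\<K> \<subseteq> (\<Union>T\<in>shadow t M. {K \<in> nsets V b. T \<subseteq> K})"
  proof
    fix K assume K: "K \<in> \<K>"
    then have Kb: "K \<in> nsets V b" "finite K" "card K = b" using \<K> by (auto simp: nsets_def)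
    have "\<exists>X\<in>M. t \<le> card (K \<inter> X)"
    proof (rule ccontr)
      assume "\<not> ?thesis"
      then have *: "\<And>X. X \<in> M \<Longrightarrow> card (K \<inter> X) < t" by force
      then have "packing t b V (insert K M)"
        using M(2) Kb unfolding packing_def by (auto simp: Int_commute)
      then have "M = insert K M" using max[of "insert K M"] M(1) K by blast
      then have "card (K \<inter> K) < t" using *[of K] by blast
      with tb Kb show False by simp
    qed
    then obtain X where X: "X \<in> M" "t \<le> card (K \<inter> X)" by blast
    then obtain T where T: "T \<subseteq> K \<inter> X" "card T = t" "finite T"
      using obtain_subset_with_card_n by metis
    then have "T \<in> shadow t M" using X(1) by (auto simp: shadow_def nsets_def)
    then show "K \<in> (\<Union>T\<in>shadow t M. {K \<in> nsets V b. T \<subseteq> K})" using T(1) Kb by blast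
  qed
  have finS: "finite (shadow t M)"
    using shadow_subset[OF M(2)] by (rule finite_subset) (simp add: V finite_imp_finite_nsets)
  have finK: "finite {K \<in> nsets V b. T \<subseteq> K}" for T
    by (simp add: V finite_imp_finite_nsets)
  have "card \<K> \<le> card (\<Union>T\<in>shadow t M. {K \<in> nsets V b. T \<subseteq> K})"
    using sub finS finK by (intro card_mono) auto
  also have "\<dots> \<le> (\<Sum>T\<in>shadow t M. card {K \<in> nsets V b. T \<subseteq> K})"
    by (rule card_UN_le[OF finS])
  also have "\<dots> \<le> (\<Sum>T\<in>shadow t M. card V ^ (b - t))"
    using shadow_subset[OF M(2)]
    by (intro sum_mono card_nsets_superset_le[OF V]) (auto simp: nsets_def)
  also have "\<dots> = card M * ((b choose t) * card V ^ (b - t))"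
    by (simp add: card_shadow[OF V M(2)])
  finally show ?thesis using M that by blast
qed

text \<open>Blocks inside different members of \<open>H\<close> meet in fewer than \<open>t\<close> points because these members do, and
  a block of \<open>M\<close> meets the others in fewer than \<open>t\<close> points because it contains no \<open>t\<close>-set covered by
  them. The assumption \<open>t \<le> b\<close> excludes that a block is counted twice.\<close>

lemma packing_union_over_host:
  fixes H :: "'a set set" and m t b D :: nat
  assumes V: "finite V" and H: "packing t m V H" and tb: "t \<le> b"
    and F: "\<And>B. B \<in> H \<Longrightarrow> packing t b B (F B) \<and> card (F B) = D"
    and M: "packing t b V M"
    and avoid: "\<And>K T B. K \<in> M \<Longrightarrow> T \<in> nsets K t \<Longrightarrow> B \<in> H \<Longrightarrow> T \<notin> shadow t (F B)"
  shows "packing t b V ((\<Union>B\<in>H. F B) \<union> M)"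
    and "card ((\<Union>B\<in>H. F B) \<union> M) = card H * D + card M"
proof -
  have B: "finite B" "B \<subseteq> V" if "B \<in> H" for B
    using H that by (auto simp: packing_def nsets_def)
  have X: "X \<subseteq> B" "finite X" "card X = b" "X \<in> nsets V b" if "B \<in> H" "X \<in> F B" for X B
    using F[OF that(1)] that(2) B[OF that(1)] by (auto simp: packing_def nsets_def)
  have K: "finite K" "card K = b" "K \<in> nsets V b" if "K \<in> M" for K
    using M that by (auto simp: packing_def nsets_def)
  have same: "card (X \<inter> Y) < t" if "B \<in> H" "X \<in> F B" "Y \<in> F B" "X \<noteq> Y" for X Y B
    using F[OF that(1)] that by (auto simp: packing_def)
  have diff: "card (X \<inter> Y) < t" if "B \<in> H" "X \<in> F B" "B' \<in> H" "Y \<in> F B'" "B \<noteq> B'" for X Y B B'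
  proof -
    have "card (X \<inter> Y) \<le> card (B \<inter> B')"
      using X(1)[OF that(1,2)] X(1)[OF that(3,4)] B(1)[OF that(1)] by (intro card_mono) auto
    also have "\<dots> < t" using H that by (auto simp: packing_def)
    finally show ?thesis .
  qed
  have mix: "card (X \<inter> K) < t" if "B \<in> H" "X \<in> F B" "K \<in> M" for X K B
  proof (rule ccontr)
    assume "\<not> ?thesis"
    then obtain T where T: "T \<subseteq> X \<inter> K" "card T = t" "finite T"
      using obtain_subset_with_card_n[of t "X \<inter> K"] by auto
    then have "T \<in> nsets K t" "T \<in> shadow t (F B)"
      using that by (auto simp: nsets_def shadow_def)
    with avoid that show False by blast
  qed
  show "packing t b V ((\<Union>B\<in>H. F B) \<union> M)"
    unfolding packing_def
  proof (intro conjI ballI impI)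
    show "(\<Union>B\<in>H. F B) \<union> M \<subseteq> nsets V b" using X(4) K(3) by blast
  next
    fix Y Z assume "Y \<in> (\<Union>B\<in>H. F B) \<union> M" "Z \<in> (\<Union>B\<in>H. F B) \<union> M" and ne: "Y \<noteq> Z"
    then consider B B' where "B \<in> H" "Y \<in> F B" "B' \<in> H" "Z \<in> F B'"
      | B where "B \<in> H" "Y \<in> F B" "Z \<in> M" | B where "B \<in> H" "Z \<in> F B" "Y \<in> M"
      | "Y \<in> M" "Z \<in> M" by blast
    then show "card (Y \<inter> Z) < t"
    proof cases
      case 1 with same diff ne show ?thesis by metis
    next
      case 2 with mix show ?thesis by blast
    next
      case 3 with mix[of B Z Y] show ?thesis by (simp add: Int_commute)
    next
      case 4 with M ne show ?thesis by (auto simp: packing_def)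
    qed
  qed
  have finF: "finite (F B)" if "B \<in> H" for B
    using packing_finite[OF B(1)[OF that]] F[OF that] by blast
  have finH: "finite H" using packing_finite[OF V H] .
  have "F B \<inter> F B' = {}" if "B \<in> H" "B' \<in> H" "B \<noteq> B'" for B B'
  proof (rule ccontr)
    assume "\<not> ?thesis"
    then obtain X0 where "X0 \<in> F B" "X0 \<in> F B'" by blast
    with diff[of B X0 B' X0] X(3)[of B X0] that tb show False by simp
  qed
  then have "card (\<Union>B\<in>H. F B) = (\<Sum>B\<in>H. card (F B))"
    using finF finH by (intro card_UN_disjoint) auto
  also have "\<dots> = card H * D" using F by simp
  finally have cardU: "card (\<Union>B\<in>H. F B) = card H * D" .
  have "(\<Union>B\<in>H. F B) \<inter> M = {}"
  proof (rule ccontr)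
    assume "\<not> ?thesis"
    then obtain X0 B where "B \<in> H" "X0 \<in> F B" "X0 \<in> M" by blast
    with mix[of B X0 X0] K(2)[of X0] tb show False by simp
  qed
  then show "card ((\<Union>B\<in>H. F B) \<union> M) = card H * D + card M"
    using cardU finF finH packing_finite[OF V M] by (simp add: card_Un_disjoint)
qed

text \<open>The improvement step: copies of a packing with \<open>D\<close> blocks in all members of \<open>H\<close>, placed so that many
  \<open>b\<close>-sets survive, together with a maximal packing among the survivors. The gain is positive as
  soon as \<open>\<delta> > 0\<close> and \<open>G\<close> is not empty.\<close>

lemma packing_refinement:
  fixes H :: "'a set set" and m t b D :: nat
  assumes V: "finite V" and H: "packing t m V H" and tm: "t \<le> m" and tb: "t \<le> b"
    and P0: "packing t b {..<m} P0" "card P0 = D"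
  defines "s \<equiv> b choose t"
  defines "\<delta> \<equiv> 1 - real (D * s) / real (m choose t)"
  defines "G \<equiv> {K \<in> nsets V b. \<forall>B\<in>H. card (K \<inter> B) \<le> t}"
  shows "\<exists>Q. packing t b V Q \<and>
    \<delta> ^ s * real (card G) \<le> (real (card Q) - real (card H * D)) * real (s * card V ^ (b - t))"
proof -
  obtain F where F: "\<forall>B\<in>H. packing t b B (F B) \<and> card (F B) = D"
    and big: "\<delta> ^ s * real (card G) \<le>
       real (card {K \<in> G. \<forall>T\<in>nsets K t. \<forall>B\<in>H. T \<notin> shadow t (F B)})"
    using random_packings_leave_uncovered[OF V H tm P0] unfolding s_def \<delta>_def G_def by blast
  let ?\<K> = "{K \<in> G. \<forall>T\<in>nsets K t. \<forall>B\<in>H. T \<notin> shadow t (F B)}"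
  have "?\<K> \<subseteq> nsets V b" by (auto simp: G_def)
  then obtain M where M: "M \<subseteq> ?\<K>" "packing t b V M"
    "card ?\<K> \<le> card M * ((b choose t) * card V ^ (b - t))"
    using maximal_packing[OF V _ tb] by blast
  let ?Q = "(\<Union>B\<in>H. F B) \<union> M"
  have avoid: "T \<notin> shadow t (F B)" if "K \<in> M" "T \<in> nsets K t" "B \<in> H" for K T B
    using M(1) that by blast
  have "packing t b V ?Q" "card ?Q = card H * D + card M"
    using packing_union_over_host[OF V H tb, of F D M] F M(2) avoid by auto
  moreover have "real (card ?\<K>) \<le> real (card M) * real (s * card V ^ (b - t))"
    unfolding of_nat_mult[symmetric] s_def using M(3) by (rule of_nat_mono)
  ultimately show ?thesis using big by (intro exI[of _ ?Q]) simp
qed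

text \<open>Each such \<open>K\<close> contains one of the \<open>(t + 1)\<close>-subsets of some \<open>B \<in> H\<close>. When \<open>H\<close> is a polynomial code
  over a large modulus this is a negligible fraction of all \<open>b\<close>-sets.\<close>

lemma card_meeting_host_much_le:
  assumes V: "finite V" and H: "packing t m V H"
  shows "card {K \<in> nsets V b. \<exists>B\<in>H. t < card (K \<inter> B)}
     \<le> card H * ((m choose Suc t) * card V ^ (b - Suc t))"
proof -
  have finH: "finite H" using packing_finite[OF V H] .
  have B: "finite B" "card B = m" if "B \<in> H" for B
    using H that by (auto simp: packing_def nsets_def)
  have fin: "finite {K \<in> nsets V b. S \<subseteq> K}" for S
    by (simp add: V finite_imp_finite_nsets)
  have finB: "finite (nsets B (Suc t))" if "B \<in> H" for B
    using B(1)[OF that] by (simp add: finite_imp_finite_nsets)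
  let ?U = "\<lambda>B. \<Union>S\<in>nsets B (Suc t). {K \<in> nsets V b. S \<subseteq> K}"
  have "{K \<in> nsets V b. \<exists>B\<in>H. t < card (K \<inter> B)} \<subseteq> (\<Union>B\<in>H. ?U B)"
  proof
    fix K assume "K \<in> {K \<in> nsets V b. \<exists>B\<in>H. t < card (K \<inter> B)}"
    then obtain B where KB: "K \<in> nsets V b" "B \<in> H" "Suc t \<le> card (K \<inter> B)" by auto
    then obtain S where "S \<subseteq> K \<inter> B" "card S = Suc t" "finite S"
      using obtain_subset_with_card_n by metis
    then have "S \<in> nsets B (Suc t)" "S \<subseteq> K" by (auto simp: nsets_def)
    then show "K \<in> (\<Union>B\<in>H. ?U B)" using KB by blast
  qed
  then have "card {K \<in> nsets V b. \<exists>B\<in>H. t < card (K \<inter> B)} \<le> card (\<Union>B\<in>H. ?U B)"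
    using finH finB fin by (intro card_mono) auto
  also have "\<dots> \<le> (\<Sum>B\<in>H. card (?U B))" by (rule card_UN_le[OF finH])
  also have "\<dots> \<le> (\<Sum>B\<in>H. (m choose Suc t) * card V ^ (b - Suc t))"
  proof (rule sum_mono)
    fix B assume BH: "B \<in> H"
    have "card (?U B) \<le> (\<Sum>S\<in>nsets B (Suc t). card {K \<in> nsets V b. S \<subseteq> K})"
      by (rule card_UN_le[OF finB[OF BH]])
    also have "\<dots> \<le> (\<Sum>S\<in>nsets B (Suc t). card V ^ (b - Suc t))"
      by (intro sum_mono card_nsets_superset_le[OF V]) (auto simp: nsets_def)
    also have "\<dots> = (m choose Suc t) * card V ^ (b - Suc t)"
      using B[OF BH] by (simp add: card_nsets)
    finally show "card (?U B) \<le> (m choose Suc t) * card V ^ (b - Suc t)" .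
  qed
  finally show ?thesis by simp
qed

section \<open>Polynomial codes as coarse packings\<close>

text \<open>A polynomial with more roots modulo \<open>N\<close> than its degree vanishes modulo \<open>N\<close>, provided that the
  differences of the roots are units: dividing off a linear factor at one root then keeps the other
  roots. This replaces the usual assumption that \<open>N\<close> is prime.\<close>

lemma const_dvd_poly_of_roots:
  fixes p :: "int poly" and N :: int
  assumes "finite I" "degree p < card I"
    and "\<And>i. i \<in> I \<Longrightarrow> N dvd poly p i"
    and "\<And>i j. i \<in> I \<Longrightarrow> j \<in> I \<Longrightarrow> i \<noteq> j \<Longrightarrow> coprime (i - j) N"
  shows "[:N:] dvd p"
  using assms
proof (induction I arbitrary: p rule: finite_induct)
  case empty
  then show ?case by simp
next
  case (insert a I)
  define q where "q = synthetic_div p a"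
  have pq: "p = [:- a, 1:] * q + [:poly p a:]"
    unfolding q_def by (rule synthetic_div_correct'[symmetric])
  have pa: "[:N:] dvd [:poly p a:]"
    using insert.prems(2)[of a] by simp
  show ?case
  proof (cases "degree p = 0")
    case True
    then have "q = 0" by (simp add: q_def synthetic_div_eq_0_iff)
    then show ?thesis using pa by (subst pq) (simp only: mult_zero_right add_0)
  next
    case False
    have "[:N:] dvd q"
    proof (rule insert.IH)
      show "degree q < card I"
        using insert.prems(1) insert.hyps False by (simp add: q_def degree_synthetic_div)
    next
      fix i assume i: "i \<in> I"
      then have "i \<noteq> a" using insert.hyps by blast
      then have cop: "coprime (i - a) N" using insert.prems(3)[of i a] i by simp
      have "poly p i = (i - a) * poly q i + poly p a"
        by (subst pq) (simp add: algebra_simps)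
      then have "(i - a) * poly q i = poly p i - poly p a" by simp
      then have "N dvd (i - a) * poly q i"
        using insert.prems(2)[of i] insert.prems(2)[of a] i by simp
      then show "N dvd poly q i"
        using cop by (simp add: coprime_commute coprime_dvd_mult_right_iff)
    next
      fix i j assume "i \<in> I" "j \<in> I" "i \<noteq> j"
      then show "coprime (i - j) N" using insert.prems(3)[of i j] by simp
    qed
    then show ?thesis
      by (subst pq) (intro dvd_add dvd_mult pa)
  qed
qed

text \<open>Reed-Solomon codes. Two polynomials of degree below \<open>t\<close> whose graphs share \<open>t\<close> points are equal. With
  a modulus coprime to \<open>m!\<close> instead of a prime, the admissible \<open>N\<close> include an arithmetic progression,
  so that every large \<open>n\<close> is close to some \<open>m N\<close> without any appeal to the distribution of primes.\<close>

lemma polynomial_code_packing: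
  assumes N: "N > 0" "coprime N (fact m)" and t: "0 < t" "t \<le> m"
  shows "\<exists>H. packing t m ({..<m} \<times> {..<N}) H \<and> card H = N ^ t"
proof -
  define C where "C = {..<t} \<rightarrow>\<^sub>E {..<N}"
  \<comment> \<open>The coefficient vectors \<open>c\<close> are the polynomials, and \<open>word c\<close> is the graph of \<open>c\<close>.\<close>
  define val where "val = (\<lambda>(c :: nat \<Rightarrow> nat) i. (\<Sum>j<t. c j * i ^ j) mod N)"
  define word where "word = (\<lambda>c. (\<lambda>i. (i, val c i)) ` {..<m})"
  have word: "word c \<in> nsets ({..<m} \<times> {..<N}) m" "card (word c) = m" for c
  proof -
    have "card (word c) = m"
      unfolding word_def by (subst card_image) (auto simp: inj_on_def)
    moreover have "word c \<subseteq> {..<m} \<times> {..<N}"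
      using N by (auto simp: word_def val_def)
    ultimately show "word c \<in> nsets ({..<m} \<times> {..<N}) m" "card (word c) = m"
      by (auto simp: nsets_def word_def)
  qed
  have cop: "coprime (i - j) (int N)" if "i \<in> int ` {..<m}" "j \<in> int ` {..<m}" "i \<noteq> j" for i j
  proof -
    have "nat \<bar>i - j\<bar> dvd fact m"
      using that by (intro dvd_fact) auto
    then have "coprime (nat \<bar>i - j\<bar>) N"
      using N(2) by (meson coprime_commute coprime_divisors dvd_refl)
    then show ?thesis
      by (metis coprime_abs_left_iff coprime_int_iff int_nat_eq abs_ge_zero)
  qed
  have inter: "card (word c \<inter> word c') < t" if c: "c \<in> C" "c' \<in> C" "c \<noteq> c'" for c c'
  proof (rule ccontr)
    assume contra: "\<not> ?thesis"
    define I where "I = {i. i < m \<and> val c i = val c' i}"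
    have "word c \<inter> word c' = (\<lambda>i. (i, val c i)) ` I"
      by (auto simp: word_def I_def)
    then have "card (word c \<inter> word c') = card I"
      by (simp add: card_image inj_on_def)
    then have I: "t \<le> card I" "finite I" using contra by (auto simp: I_def)
    define p where "p = (\<Sum>j<t. monom (int (c j) - int (c' j)) j)"
    have coeff: "coeff p j = int (c j) - int (c' j)" if "j < t" for j
      using that by (simp add: p_def coeff_sum if_distrib sum.delta cong: if_cong)
    have "degree p < t"
      unfolding p_def using t(1)
      by (intro degree_sum_less) (auto intro: le_less_trans[OF degree_monom_le])
    then have "degree p < card (int ` I)"
      using I by (simp add: card_image)
    moreover have "int N dvd poly p x" if x: "x \<in> int ` I" for x
    proof -
      obtain i where i: "i \<in> I" "x = int i" using x by blast
      have "poly p x = int (\<Sum>j<t. c j * i ^ j) - int (\<Sum>j<t. c' j * i ^ j)"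
        by (simp add: p_def poly_sum poly_monom i left_diff_distrib sum_subtractf)
      moreover have "int (\<Sum>j<t. c j * i ^ j) mod int N = int (\<Sum>j<t. c' j * i ^ j) mod int N"
        using i(1) unfolding I_def val_def by (simp only: zmod_int[symmetric]) simp
      ultimately show ?thesis by (simp add: mod_eq_dvd_iff)
    qed
    moreover have "coprime (i - j) (int N)" if "i \<in> int ` I" "j \<in> int ` I" "i \<noteq> j" for i j
      using that by (intro cop) (auto simp: I_def)
    ultimately have dvd: "[:int N:] dvd p"
      using I(2) by (intro const_dvd_poly_of_roots[of "int ` I"]) auto
    have "c j = c' j" if "j < t" for j
    proof -
      have "int N dvd int (c j) - int (c' j)"
        using dvd coeff[OF that, symmetric] by (simp add: const_poly_dvd_iff)
      then have "int (c j) mod int N = int (c' j) mod int N" by (simp add: mod_eq_dvd_iff)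
      moreover have "c j < N" "c' j < N" using c that by (auto simp: C_def PiE_iff)
      ultimately show ?thesis by simp
    qed
    then have "c = c'" using c(1,2) unfolding C_def by (intro PiE_ext) auto
    with c(3) show False by simp
  qed
  have "inj_on word C"
  proof (rule inj_onI, rule ccontr)
    fix c c' assume *: "c \<in> C" "c' \<in> C" "word c = word c'" "c \<noteq> c'"
    have "card (word c) < t" using inter[OF *(1,2,4)] *(3) by simp
    then show False using word(2)[of c] t(2) by simp
  qed
  then have "card (word ` C) = N ^ t"
    by (simp add: card_image C_def card_PiE)
  moreover have "packing t m ({..<m} \<times> {..<N}) (word ` C)"
    unfolding packing_def
  proof (intro conjI ballI impI)
    show "word ` C \<subseteq> nsets ({..<m} \<times> {..<N}) m"
      by (intro image_subsetI word(1))
    fix X Y assume "X \<in> word ` C" "Y \<in> word ` C" "X \<noteq> Y"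
    then obtain c c' where "X = word c" "c \<in> C" "Y = word c'" "c' \<in> C"
      by (elim imageE)
    moreover from this \<open>X \<noteq> Y\<close> have "c \<noteq> c'" by metis
    ultimately show "card (X \<inter> Y) < t" using inter[of c c'] by simp
  qed
  ultimately show ?thesis by (intro exI[of _ "word ` C"] conjI)
qed

text \<open>The polynomial code serves as \<open>H\<close> in the improvement step. The subtracted term bounds the number of
  \<open>b\<close>-sets that meet some graph in more than \<open>t\<close> points; it is smaller by a factor of order \<open>N\<close> than
  the number of all \<open>b\<close>-sets.\<close>

lemma packing_number_blowup:
  assumes N: "N > 0" "coprime N (fact m)" and t: "0 < t" "t \<le> m" "t \<le> b"
  defines "s \<equiv> b choose t"
  defines "D \<equiv> packing_number t b m"
  defines "\<delta> \<equiv> 1 - real (D * s) / real (m choose t)"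
  shows "\<delta> ^ s * (real (m * N choose b) - real (m ^ b * N ^ (b - 1)))
    \<le> (real (packing_number t b (m * N)) - real (N ^ t * D)) * real (s * (m * N) ^ (b - t))"
proof -
  let ?V = "{..<m} \<times> {..<N}"
  have V: "finite ?V" "card ?V = m * N" by simp_all
  obtain H where H: "packing t m ?V H" "card H = N ^ t"
    using polynomial_code_packing[OF N t(1,2)] by blast
  obtain P0 where P0: "packing t b {..<m} P0" "card P0 = D"
    using packing_number_witness D_def by blast
  define G where "G = {K \<in> nsets ?V b. \<forall>B\<in>H. card (K \<inter> B) \<le> t}"
  obtain Q where Q: "packing t b ?V Q"
    "\<delta> ^ s * real (card G) \<le> (real (card Q) - real (N ^ t * D)) * real (s * (m * N) ^ (b - t))"
    using packing_refinement[OF V(1) H(1) t(2,3) P0]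
    unfolding V(2) H(2) s_def[symmetric] \<delta>_def[symmetric] G_def[symmetric] by (elim exE conjE)
  have QD: "card Q \<le> packing_number t b (m * N)"
    using packing_number_ge_card[OF V(1) _ Q(1)] V(2) by simp
  let ?bad = "{K \<in> nsets ?V b. \<exists>B\<in>H. t < card (K \<inter> B)}"
  \<comment> \<open>For \<open>b = t\<close> the truncated exponent \<open>b - Suc t\<close> makes the general count too large, but then no
      \<open>b\<close>-set meets a graph in more than \<open>t\<close> points.\<close>
  have bad: "card ?bad \<le> m ^ b * N ^ (b - 1)"
  proof (cases "b = t")
    case True
    have "card (K \<inter> B) \<le> t" if "K \<in> nsets ?V b" for K B
      using that card_mono[of K "K \<inter> B"] True by (auto simp: nsets_def)
    then have "?bad = {}" by (auto simp: not_less)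
    then show ?thesis by (simp only: card.empty)
  next
    case False
    then obtain d where d: "b = Suc t + d" using t(3) le_Suc_ex[of "Suc t" b] by auto
    have "m choose Suc t \<le> m ^ Suc t"
      by (rule binomial_le_power)
    then have "N ^ t * ((m choose Suc t) * (m * N) ^ (b - Suc t)) \<le> N ^ t * (m ^ Suc t * (m * N) ^ d)"
      using d by (intro mult_le_mono) auto
    also have "\<dots> = m ^ b * N ^ (b - 1)"
      by (simp add: d power_add power_mult_distrib)
    finally show ?thesis
      using card_meeting_host_much_le[OF V(1) H(1), of b] V(2) H(2) by simp
  qed
  have "nsets ?V b = G \<union> ?bad" by (auto simp: G_def not_le)
  moreover have "finite (nsets ?V b)" using V(1) by (rule finite_imp_finite_nsets)
  ultimately have "m * N choose b \<le> card G + card ?bad"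
    using card_Un_le[of G ?bad] card_nsets[OF V(1), of b] V(2) by simp
  also have "\<dots> \<le> card G + m ^ b * N ^ (b - 1)" using bad by (rule add_left_mono)
  finally have "real (m * N choose b) \<le> real (card G + m ^ b * N ^ (b - 1))"
    by (rule of_nat_mono)
  then have G: "real (m * N choose b) - real (m ^ b * N ^ (b - 1)) \<le> real (card G)"
    by simp
  have "D * s \<le> m choose t"
    unfolding D_def s_def by (rule packing_number_le)
  then have "0 \<le> \<delta>"
    unfolding \<delta>_def using t(2) by (simp add: divide_le_eq flip: of_nat_mult)
  then have "\<delta> ^ s * (real (m * N choose b) - real (m ^ b * N ^ (b - 1))) \<le> \<delta> ^ s * real (card G)"
    using G by (intro mult_left_mono) auto
  also note Q(2)
  also have "(real (card Q) - real (N ^ t * D)) * real (s * (m * N) ^ (b - t))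
    \<le> (real (packing_number t b (m * N)) - real (N ^ t * D)) * real (s * (m * N) ^ (b - t))"
    using QD by (intro mult_right_mono) auto
  finally show ?thesis .
qed

section \<open>Asymptotically perfect packings\<close>

lemma binomial_over_power_tendsto:
  "(\<lambda>n. real (n choose b) / real n ^ b) \<longlonglongrightarrow> 1 / fact b"
proof -
  have "(\<lambda>n. (real n - real i) / real n) \<longlonglongrightarrow> 1" for i
    by real_asymp
  then have "(\<lambda>n. (\<Prod>i = 0..<b. (real n - real i) / real n) / fact b) \<longlonglongrightarrow> (\<Prod>i = 0..<b. 1) / fact b"
    by (intro tendsto_divide tendsto_prod tendsto_const) auto
  moreover have "(\<Prod>i = 0..<b. (real n - real i) / real n) / fact b = real (n choose b) / real n ^ b" for n
    by (simp add: prod_dividef binomial_gbinomial gbinomial_prod_rev)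
  ultimately show ?thesis by simp
qed

lemma packing_number_mono: "m \<le> n \<Longrightarrow> packing_number t b m \<le> packing_number t b n"
  using packing_number_witness[of t b m] packing_number_ge_card[of "{..<m}" n t b]
  by (metis card_lessThan finite_lessThan)

text \<open>The normalisation by \<open>n ^ t\<close> instead of \<open>n choose t\<close> makes the blow-up from \<open>m\<close> to \<open>m N\<close> points free of
  loss, because the code has exactly \<open>N ^ t\<close> members.\<close>

definition packing_ratio :: "nat \<Rightarrow> nat \<Rightarrow> nat \<Rightarrow> real" where
  "packing_ratio t b n = real (packing_number t b n) / real n ^ t"

definition uncovered_fraction :: "nat \<Rightarrow> nat \<Rightarrow> nat \<Rightarrow> real" where
  "uncovered_fraction t b m = 1 - real (packing_number t b m * (b choose t)) / real (m choose t)"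

lemma packing_ratio_le:
  assumes t: "0 < t" and tb: "t \<le> b"
  defines "s \<equiv> b choose t"
  shows "packing_ratio t b n \<le> 1 / (fact t * real s)"
proof (cases "n = 0")
  case True
  then show ?thesis using t by (simp add: packing_ratio_def zero_power)
next
  case False
  have "packing_number t b n * s * fact t \<le> (n choose t) * fact t"
    unfolding s_def by (intro mult_right_mono packing_number_le) simp
  also have "\<dots> \<le> n ^ t" by (rule binomial_fact_pow)
  finally have "real (packing_number t b n * s * fact t) \<le> real (n ^ t)" by (rule of_nat_mono)
  then show ?thesis
    using False tb by (simp add: packing_ratio_def s_def field_simps)
qed

lemma uncovered_fraction_nonneg: "t \<le> m \<Longrightarrow> 0 \<le> uncovered_fraction t b m"
  using packing_number_le[of t b m] unfolding uncovered_fraction_def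
  by (simp add: divide_le_eq flip: of_nat_mult)

lemma packing_ratio_blowup:
  assumes t: "0 < t" and tb: "t \<le> b" and m: "t \<le> m" and N: "N > 0" "coprime N (fact m)"
  defines "s \<equiv> b choose t"
  shows "packing_ratio t b m + uncovered_fraction t b m ^ s / real s * (real (m * N choose b) / real (m * N) ^ b - 1 / real N)
    \<le> packing_ratio t b (m * N)"
proof -
  have s_pos: "s > 0" using tb by (simp add: s_def)
  let ?D = "packing_number t b"
  let ?M = "real (m * N)"
  have pos: "real m > 0" "real N > 0" "?M > 0" "real s > 0" using N m t s_pos by auto
  have "(real (m * N choose b) / ?M ^ b - 1 / real N) * ?M ^ b
      = real (m * N choose b) - real (m ^ b * N ^ (b - 1))"
  proof -
    have "real N ^ b = real N * real N ^ (b - 1)"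
      using t tb by (cases b) auto
    then show ?thesis using pos by (simp add: field_simps power_mult_distrib)
  qed
  then have "uncovered_fraction t b m ^ s * (real (m * N choose b) / ?M ^ b - 1 / real N) * ?M ^ b
    \<le> (real (?D (m * N)) - real (N ^ t * ?D m)) * real (s * (m * N) ^ (b - t))"
    using packing_number_blowup[OF N t m tb] by (simp add: uncovered_fraction_def s_def mult.assoc)
  also have "\<dots> = (packing_ratio t b (m * N) - packing_ratio t b m) * real s * ?M ^ b"
  proof -
    have "?M ^ b = ?M ^ t * ?M ^ (b - t)" using tb by (simp flip: power_add)
    moreover have "(packing_ratio t b (m * N) - packing_ratio t b m) * ?M ^ t = real (?D (m * N)) - real (N ^ t * ?D m)"
      using pos by (simp add: packing_ratio_def left_diff_distrib power_mult_distrib field_simps)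
    ultimately show ?thesis by (simp add: mult_ac)
  qed
  finally have "uncovered_fraction t b m ^ s * (real (m * N choose b) / ?M ^ b - 1 / real N) \<le> (packing_ratio t b (m * N) - packing_ratio t b m) * real s"
    using pos by (simp add: mult_le_cancel_right_pos)
  then show ?thesis using pos by (simp add: field_simps)
qed

text \<open>Every \<open>n \<ge> m\<close> is approximated from below by some \<open>m * N n\<close> with \<open>N n\<close> congruent to \<open>1\<close> modulo \<open>m!\<close>,
  up to an error that is bounded in terms of \<open>m\<close>. As \<open>N\<close> grows, the bracket in \<open>packing_ratio_blowup\<close>
  tends to \<open>1 / b!\<close>.\<close>

lemma packing_ratio_eventually_gt:
  assumes t: "0 < t" and tb: "t \<le> b" and m: "t \<le> m"
  defines "s \<equiv> b choose t"
  assumes x: "x < packing_ratio t b m + uncovered_fraction t b m ^ s / (real s * fact b)"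
  shows "eventually (\<lambda>n. x < packing_ratio t b n) sequentially"
proof -
  have m0: "m > 0" using m t by simp
  define h where "h = (\<lambda>N. packing_ratio t b m + uncovered_fraction t b m ^ s / real s * (real (m * N choose b) / real (m * N) ^ b - 1 / real N))"
  define L where "L = packing_ratio t b m + uncovered_fraction t b m ^ s / (real s * fact b)"
  have mN: "filterlim (\<lambda>N. m * N) at_top sequentially"
    using m0 by (intro filterlim_at_top_mono[OF filterlim_ident]) (auto simp: eventually_at_top_linorder)
  have "h \<longlonglongrightarrow> packing_ratio t b m + uncovered_fraction t b m ^ s / real s * (1 / fact b - 0)"
    unfolding h_def
    by (intro tendsto_intros filterlim_compose[OF binomial_over_power_tendsto mN] lim_inverse_n')
  then have h: "h \<longlonglongrightarrow> L" by (simp add: L_def)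
  \<comment> \<open>The largest number congruent to \<open>1\<close> modulo \<open>m!\<close> that is at most \<open>n div m\<close>, for \<open>n \<ge> m\<close>.\<close>
  define N where "N = (\<lambda>n. fact m * ((n div m - 1) div fact m) + 1 :: nat)"
  have cop: "coprime (N n) (fact m)" for n
  proof (rule coprimeI)
    fix d assume "d dvd N n" "d dvd fact m"
    then show "is_unit d"
      unfolding N_def using dvd_add_right_iff[of d "fact m * ((n div m - 1) div fact m)" 1]
      by (simp only: dvd_mult2)
  qed
  have up: "m * N n \<le> n" if "m \<le> n" for n
  proof -
    have "n div m \<ge> 1" using that m0 by (simp add: div_greater_zero_iff Suc_le_eq)
    then have "N n \<le> n div m" unfolding N_def
      using times_div_less_eq_dividend[of "fact m :: nat" "n div m - 1"] by linarith
    then have "m * N n \<le> m * (n div m)" by simp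
    also have "\<dots> \<le> n" by simp
    finally show ?thesis .
  qed
  define c where "c = real (m * (fact m + 1))"
  have low: "real n - c \<le> real (m * N n)" for n
  proof -
    have "n div m < N n + fact m"
    proof -
      have "n div m - 1 < fact m * ((n div m - 1) div fact m) + (fact m :: nat)"
        using dividend_less_times_div[of "fact m :: nat" "n div m - 1"] by (simp add: add.commute)
      then show ?thesis unfolding N_def by linarith
    qed
    then have "m * Suc (n div m) \<le> m * (N n + fact m)"
      by (intro mult_le_mono2) simp
    then have "m * (n div m) + m \<le> m * (N n + fact m)" by simp
    moreover have "n < m * (n div m) + m"
      using mod_less_divisor[OF m0, of n] mult_div_mod_eq[of m n] by linarith
    ultimately have "n \<le> m * N n + m * (fact m + 1)" by (simp add: algebra_simps)
    then have "real n \<le> real (m * N n) + c" unfolding c_def of_nat_add[symmetric] by (rule of_nat_mono)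
    then show ?thesis by simp
  qed
  have Ninf: "filterlim N at_top sequentially"
  proof -
    have "filterlim (\<lambda>n. real n - c) at_top sequentially" by real_asymp
    then have "filterlim (\<lambda>n. real (m * N n)) at_top sequentially"
      by (rule filterlim_at_top_mono) (use low in auto)
    then have "filterlim (\<lambda>n. (1 / real m) * real (m * N n)) at_top sequentially"
      using m0 by (intro filterlim_tendsto_pos_mult_at_top[OF tendsto_const]) auto
    then show ?thesis using m0 by (simp add: filterlim_sequentially_iff_filterlim_real)
  qed
  have ratio: "(\<lambda>n. real (m * N n) / real n) \<longlonglongrightarrow> 1"
  proof (rule tendsto_sandwich)
    show "(\<lambda>n. 1 - c / real n) \<longlonglongrightarrow> 1" by real_asymp
    show "\<forall>\<^sub>F n in sequentially. 1 - c / real n \<le> real (m * N n) / real n"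
      using eventually_gt_at_top[of 0]
    proof eventually_elim
      case (elim n)
      have "1 - c / real n = (real n - c) / real n" using elim by (simp add: diff_divide_distrib)
      also have "\<dots> \<le> real (m * N n) / real n" using low by (rule divide_right_mono) simp
      finally show ?case .
    qed
    show "\<forall>\<^sub>F n in sequentially. real (m * N n) / real n \<le> 1"
      using eventually_ge_at_top[of "max m 1"]
    proof eventually_elim
      case (elim n)
      then have "real (m * N n) \<le> real n" using up by (intro of_nat_mono) simp
      then show ?case using elim by (simp add: divide_le_eq)
    qed
  qed auto
  have "(\<lambda>n. h (N n) * (real (m * N n) / real n) ^ t) \<longlonglongrightarrow> L * 1 ^ t"
    by (intro tendsto_intros filterlim_compose[OF h Ninf] ratio)
  then have "\<forall>\<^sub>F n in sequentially. x < h (N n) * (real (m * N n) / real n) ^ t"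
    using x by (intro order_tendstoD(1)[where y = L]) (auto simp: L_def)
  then show ?thesis using eventually_ge_at_top[of "max m 1"]
  proof eventually_elim
    case (elim n)
    have Npos: "N n > 0" by (simp add: N_def)
    have "h (N n) * (real (m * N n) / real n) ^ t \<le> packing_ratio t b (m * N n) * (real (m * N n) / real n) ^ t"
      unfolding h_def by (intro mult_right_mono packing_ratio_blowup[OF t tb m Npos cop, folded s_def]) simp
    also have "\<dots> = real (packing_number t b (m * N n)) / real n ^ t"
      using Npos m0 by (simp add: packing_ratio_def power_divide)
    also have "\<dots> \<le> packing_ratio t b n"
      unfolding packing_ratio_def using up elim by (intro divide_right_mono of_nat_mono packing_number_mono) auto
    finally show ?case using elim by linarith
  qed
qed

text \<open>Let \<open>A\<close> be the supremum of the ratios. Since the ratio at any \<open>m \<ge> t\<close> is nearly a lower bound for all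
  later ones, the ratios converge to \<open>A\<close>, and the uncovered fractions converge to
  \<open>1 - s * A * t!\<close>. The gain in the improvement step cannot lead beyond \<open>A\<close>, so in the limit it is \<open>0\<close>,
  which forces \<open>A = 1 / (t! * s)\<close>.\<close>

theorem packing_ratio_tendsto:
  assumes t: "0 < t" and tb: "t \<le> b"
  shows "packing_ratio t b \<longlonglongrightarrow> 1 / (fact t * real (b choose t))"
proof -
  define s where "s = b choose t"
  have s_pos: "s > 0" using tb by (simp add: s_def)
  note packing_ratio_le = packing_ratio_le[OF t tb, folded s_def]
  note packing_ratio_eventually_gt = packing_ratio_eventually_gt[OF t tb, folded s_def]
  define A where "A = (SUP n. packing_ratio t b n)"
  have bdd: "bdd_above (range (packing_ratio t b))" by (rule bdd_aboveI2[OF packing_ratio_le])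
  have eA: "packing_ratio t b n \<le> A" for n unfolding A_def by (intro cSUP_upper bdd) simp
  have Ale: "A \<le> 1 / (fact t * real s)" unfolding A_def by (intro cSUP_least packing_ratio_le) simp
  have \<delta>0: "0 \<le> uncovered_fraction t b m ^ s / (real s * fact b)" if "t \<le> m" for m
    using uncovered_fraction_nonneg[OF that] by simp
  have lim: "packing_ratio t b \<longlonglongrightarrow> A"
  proof (rule order_tendstoI)
    fix x assume "x < A"
    then obtain m where m: "x < packing_ratio t b m" unfolding A_def using less_cSUP_iff[OF _ bdd] by auto
    \<comment> \<open>The improvement step applies to \<open>m\<close> only if \<open>t \<le> m\<close>; a positive ratio at \<open>m\<close> guarantees this.\<close>
    show "\<forall>\<^sub>F n in sequentially. x < packing_ratio t b n"
    proof (cases "x < 0")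
      case True
      have "0 \<le> packing_ratio t b n" for n by (simp add: packing_ratio_def)
      with True show ?thesis by (intro always_eventually allI) (rule less_le_trans)
    next
      case False
      then have "packing_ratio t b m > 0" using m by linarith
      then have "t \<le> m"
        using packing_number_le[of t b m] s_pos by (cases "t \<le> m") (auto simp: packing_ratio_def s_def binomial_eq_0)
      then show ?thesis using packing_ratio_eventually_gt[of m x] m \<delta>0[of m] by linarith
    qed
  next
    fix x assume "A < x"
    then show "\<forall>\<^sub>F n in sequentially. packing_ratio t b n < x"
      by (intro always_eventually allI) (rule le_less_trans[OF eA])
  qed
  have gain: "packing_ratio t b m + uncovered_fraction t b m ^ s / (real s * fact b) \<le> A" if "t \<le> m" for m
  proof (rule ccontr)
    assume "\<not> ?thesis"
    then have "\<forall>\<^sub>F n in sequentially. A < packing_ratio t b n"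
      by (intro packing_ratio_eventually_gt[OF that]) simp
    then obtain n where "A < packing_ratio t b n" by (auto simp: eventually_at_top_linorder)
    with eA[of n] show False by simp
  qed
  have "(\<lambda>m. 1 - real s * packing_ratio t b m / (real (m choose t) / real m ^ t)) \<longlonglongrightarrow> 1 - real s * A / (1 / fact t)"
    by (intro tendsto_intros lim binomial_over_power_tendsto) simp
  moreover have "\<forall>\<^sub>F m in sequentially. 1 - real s * packing_ratio t b m / (real (m choose t) / real m ^ t) = uncovered_fraction t b m"
    using eventually_gt_at_top[of 0] by eventually_elim (simp add: uncovered_fraction_def s_def packing_ratio_def)
  ultimately have "uncovered_fraction t b \<longlonglongrightarrow> 1 - real s * A / (1 / fact t)"
    by (rule Lim_transform_eventually)
  then have "uncovered_fraction t b \<longlonglongrightarrow> 1 - real s * A * fact t" by simp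
  then have "(\<lambda>m. packing_ratio t b m + uncovered_fraction t b m ^ s / (real s * fact b)) \<longlonglongrightarrow> A + (1 - real s * A * fact t) ^ s / (real s * fact b)"
    by (intro tendsto_intros lim) (use s_pos in auto)
  then have "A + (1 - real s * A * fact t) ^ s / (real s * fact b) \<le> A"
    by (rule LIMSEQ_le_const2) (use gain in blast)
  then have "(1 - real s * A * fact t) ^ s \<le> 0"
    using s_pos pos_divide_le_eq[of "real s * fact b" "(1 - real s * A * fact t) ^ s" 0] by simp
  moreover have "0 \<le> 1 - real s * A * fact t"
    using Ale s_pos by (simp add: field_simps)
  ultimately have "1 - real s * A * fact t = 0"
    using zero_less_power[of "1 - real s * A * fact t" s] by linarith
  then have "A = 1 / (fact t * real s)" using s_pos by (simp add: field_simps)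
  with lim show ?thesis by (simp add: s_def)
qed

text \<open>Each \<open>t\<close>-set that an optimal packing on \<open>n - 1\<close> points misses costs at most one extra edge; their
  number is the error term of the theorem.\<close>

lemma uncovered_count_smallo:
  assumes t: "0 < t" and tb: "t \<le> b"
  shows "(\<lambda>n. real (n - 1 choose t) - real (packing_number t b (n - 1) * (b choose t)))
    \<in> o(\<lambda>n. real n ^ t)"
proof (rule smalloI_tendsto)
  define g where "g = (\<lambda>n. real (n - 1 choose t) - real (packing_number t b (n - 1) * (b choose t)))"
  have "(\<lambda>m. (real (m choose t) / real m ^ t - packing_ratio t b m * real (b choose t))
      * (real m / real (Suc m)) ^ t)
    \<longlonglongrightarrow> (1 / fact t - 1 / (fact t * real (b choose t)) * real (b choose t)) * 1 ^ t"
    by (intro tendsto_intros binomial_over_power_tendsto packing_ratio_tendsto[OF t tb] LIMSEQ_n_over_Suc_n)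
  moreover have "\<forall>\<^sub>F m in sequentially.
      (real (m choose t) / real m ^ t - packing_ratio t b m * real (b choose t))
      * (real m / real (Suc m)) ^ t = g (Suc m) / real (Suc m) ^ t"
    using eventually_gt_at_top[of 0]
    by eventually_elim (simp add: g_def packing_ratio_def power_divide field_simps del: of_nat_Suc)
  ultimately have "(\<lambda>m. g (Suc m) / real (Suc m) ^ t)
    \<longlonglongrightarrow> (1 / fact t - 1 / (fact t * real (b choose t)) * real (b choose t)) * 1 ^ t"
    by (rule Lim_transform_eventually)
  then have "(\<lambda>m. g (Suc m) / real (Suc m) ^ t) \<longlonglongrightarrow> 0" using tb by simp
  then have "(\<lambda>n. g n / real n ^ t) \<longlonglongrightarrow> 0"
    by (rule iffD1[OF filterlim_sequentially_Suc[of "\<lambda>n. g n / real n ^ t"]])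
  then show "(\<lambda>n. (real (n - 1 choose t) - real (packing_number t b (n - 1) * (b choose t))) / real n ^ t)
    \<longlonglongrightarrow> 0"
    unfolding g_def .
  show "\<forall>\<^sub>F n in sequentially. real n ^ t \<noteq> 0"
    using eventually_gt_at_top[of 0] by eventually_elim simp
qed

section \<open>Crossing hypergraphs from coverings\<close>

text \<open>Given a partition, apply the covering property to a system of representatives of the classes that
  do not contain \<open>x\<close>.\<close>

lemma cone_over_covering_crosses:
  fixes V :: "'a set"
  assumes x: "x \<notin> V" and C: "C \<subseteq> nsets V (r - 1)"
    and cover: "\<And>T. T \<in> nsets V (k - 1) \<Longrightarrow> \<exists>B\<in>C. T \<subseteq> B"
    and k: "0 < k" "k \<le> r"
  shows "crossing_hypergraph k r (insert x V) (insert x ` C)"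
proof -
  have C': "B \<subseteq> V" "finite B" "card B = r - 1" "card (insert x B) = r" if "B \<in> C" for B
  proof -
    show *: "B \<subseteq> V" "finite B" "card B = r - 1"
      using C that by (auto simp: nsets_def)
    then have "x \<notin> B" using x by auto
    then show "card (insert x B) = r" using * k by simp
  qed
  have "hypergraph_crosses (insert x ` C) \<P>" if P: "k_partition k (insert x V) \<P>" for \<P> :: "'a set set"
  proof -
    have part: "partition_on (insert x V) \<P>" and fin: "finite \<P>" and cardP: "card \<P> = k"
      using P by (auto simp: k_partition_def)
    have "x \<in> \<Union>\<P>" using partition_onD1[OF part] by auto
    then obtain A0 where A0: "A0 \<in> \<P>" "x \<in> A0" by blast
    have disj: "A = A'" if "A \<in> \<P>" "A' \<in> \<P>" "a \<in> A" "a \<in> A'" for A A' a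
      using disjointD[OF partition_onD2[OF part] that(1,2)] that(3,4) by auto
    define rep where "rep = (\<lambda>A :: 'a set. SOME a. a \<in> A)"
    have rep: "rep A \<in> A" if "A \<in> \<P>" for A
    proof -
      have "A \<noteq> {}" using partition_onD3[OF part] that by auto
      then show ?thesis unfolding rep_def by (rule some_in_eq[THEN iffD2])
    qed
    let ?T = "rep ` (\<P> - {A0})"
    have "inj_on rep (\<P> - {A0})"
    proof (rule inj_onI)
      fix A A' assume "A \<in> \<P> - {A0}" "A' \<in> \<P> - {A0}" "rep A = rep A'"
      then show "A = A'" using disj[of A A' "rep A"] rep[of A] rep[of A'] by auto
    qed
    then have "card ?T = k - 1"
      using A0 fin cardP by (simp add: card_image)
    moreover have "?T \<subseteq> V"
    proof
      fix a assume "a \<in> ?T"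
      then obtain A where A: "A \<in> \<P>" "A \<noteq> A0" "a = rep A" by auto
      then have "a \<in> A" using rep by simp
      then have "a \<noteq> x" using disj[of A A0 a] A A0 by auto
      moreover have "a \<in> insert x V" using partition_onD1[OF part] \<open>a \<in> A\<close> A(1) by auto
      ultimately show "a \<in> V" by simp
    qed
    ultimately have "?T \<in> nsets V (k - 1)" using fin by (simp add: nsets_def)
    then obtain B where B: "B \<in> C" "?T \<subseteq> B" using cover by blast
    have "insert x B \<inter> A \<noteq> {}" if "A \<in> \<P>" for A
    proof (cases "A = A0")
      case True
      then show ?thesis using A0 by auto
    next
      case False
      then have "rep A \<in> B" using B(2) that by auto
      then show ?thesis using rep[OF that] by auto
    qed
    then have "{A \<in> \<P>. insert x B \<inter> A \<noteq> {}} = \<P>" by auto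
    then have "set_crosses (insert x B) \<P>"
      unfolding set_crosses_def using C'(4)[OF B(1)] cardP k by simp
    then show ?thesis unfolding hypergraph_crosses_def using B(1) by auto
  qed
  moreover have "uniform_hypergraph r (insert x V) (insert x ` C)"
    unfolding uniform_hypergraph_def using C'(1,4) by auto
  ultimately show ?thesis unfolding crossing_hypergraph_def by blast
qed

text \<open>The covering consists of an optimal packing and one block for each \<open>(k - 1)\<close>-set that it misses; the apex
  of the cone is the point \<open>n - 1\<close>.\<close>

lemma min_crossing_edges_le:
  assumes k: "0 < k" "k \<le> r" and n: "r \<le> n"
  defines "D \<equiv> packing_number (k - 1) (r - 1) (n - 1)"
  shows "min_crossing_edges n k r \<le> D + ((n - 1 choose (k - 1)) - D * (r - 1 choose (k - 1)))"
proof -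
  define t where "t = k - 1"
  define b where "b = r - 1"
  let ?V = "{..<n - 1}"
  have tb: "t \<le> b" "b \<le> n - 1" using k n by (auto simp: t_def b_def)
  obtain P where P: "packing t b ?V P" "card P = D"
    using packing_number_witness unfolding D_def t_def b_def by blast
  define U where "U = nsets ?V t - shadow t P"
  have finU: "finite U" by (simp add: U_def finite_imp_finite_nsets)
  have finP: "finite P" using packing_finite[OF _ P(1)] by simp
  have "finite (shadow t P)"
    using shadow_subset[OF P(1)] by (rule finite_subset) (simp add: finite_imp_finite_nsets)
  then have cardU: "card U = (n - 1 choose t) - D * (b choose t)"
    using card_Diff_subset[OF _ shadow_subset[OF P(1)]] card_shadow[OF _ P(1)] P(2)
    by (simp add: U_def card_nsets)
  have "\<exists>B. B \<in> nsets ?V b \<and> T \<subseteq> B" if "T \<in> U" for T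
  proof -
    have "T \<subseteq> ?V" "card T = t" using that by (auto simp: U_def nsets_def)
    then obtain B where "T \<subseteq> B" "B \<subseteq> ?V" "card B = b"
      using exists_subset_between[of T b ?V] tb by auto
    then show ?thesis by (auto simp: nsets_def intro: finite_subset)
  qed
  then obtain g where g: "\<And>T. T \<in> U \<Longrightarrow> g T \<in> nsets ?V b \<and> T \<subseteq> g T"
    by metis
  let ?C = "P \<union> g ` U"
  have "crossing_hypergraph k r (insert (n - 1) ?V) (insert (n - 1) ` ?C)"
  proof (rule cone_over_covering_crosses)
    show "?C \<subseteq> nsets ?V (r - 1)"
      using P(1) g by (auto simp: packing_def b_def)
    fix T assume T: "T \<in> nsets ?V (k - 1)"
    show "\<exists>B\<in>?C. T \<subseteq> B"
    proof (cases "T \<in> U")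
      case True
      then show ?thesis using g by blast
    next
      case False
      then have "T \<in> shadow t P" using T by (simp add: U_def t_def)
      then obtain X where "X \<in> P" "T \<subseteq> X" by (auto simp: shadow_def nsets_def)
      then show ?thesis by blast
    qed
  qed (use k in auto)
  moreover have "insert (n - 1) ?V = {..<n}" using k n by auto
  ultimately have "crossing_hypergraph k r {..<n} (insert (n - 1) ` ?C)" by simp
  then have "min_crossing_edges n k r \<le> card (insert (n - 1) ` ?C)"
    unfolding min_crossing_edges_def by (intro Least_le exI[of _ "insert (n - 1) ` ?C"] conjI refl)
  also have "\<dots> \<le> card ?C" using finP finU by (intro card_image_le) simp
  also have "\<dots> \<le> card P + card (g ` U)" by (rule card_Un_le)
  also have "\<dots> \<le> D + card U" using P(2) card_image_le[OF finU, of g] by simp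
  finally show ?thesis using cardU by (simp add: t_def b_def)
qed

lemma choose_absorption_ratio:
  assumes k: "0 < k" "k \<le> r" and n: "r \<le> n"
  shows "real (n choose k) / real (r choose k) * (real r / real n)
    = real (n - 1 choose (k - 1)) / real (r - 1 choose (k - 1))"
proof -
  have absorb: "real k * real (m choose k) = real m * real (m - 1 choose (k - 1))" for m
    using times_binomial_minus1_eq[OF k(1), of m] by (simp flip: of_nat_mult)
  have pos: "real (r choose k) > 0" "real (r - 1 choose (k - 1)) > 0" "real n > 0" "real r > 0" "real k > 0"
    using k n by auto
  have "real (n choose k) = real n * real (n - 1 choose (k - 1)) / real k"
    "real (r choose k) = real r * real (r - 1 choose (k - 1)) / real k"
    using absorb[of n] absorb[of r] pos by (simp_all add: field_simps)
  then show ?thesis using pos by simp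
qed

theorem proposition10:
  fixes r k :: nat
  assumes "r \<ge> k" and "k \<ge> 2"
  shows "\<exists>g :: nat \<Rightarrow> real.
           g \<in> o(\<lambda>n. real n ^ (k - 1)) \<and>
           (\<forall>n\<ge>r. real (min_crossing_edges n k r)
              \<le> real (n choose k) / real (r choose k) * (real r / real n) + g n)"
proof (intro exI conjI allI impI)
  let ?D = "\<lambda>n. packing_number (k - 1) (r - 1) (n - 1)"
  let ?s = "r - 1 choose (k - 1)"
  let ?g = "\<lambda>n. real (n - 1 choose (k - 1)) - real (?D n * ?s)"
  show "?g \<in> o(\<lambda>n. real n ^ (k - 1))"
    using assms by (intro uncovered_count_smallo) auto
  fix n assume n: "r \<le> n"
  have le: "?D n * ?s \<le> n - 1 choose (k - 1)" by (rule packing_number_le)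
  have "real (min_crossing_edges n k r) \<le> real (?D n + ((n - 1 choose (k - 1)) - ?D n * ?s))"
    using assms n by (intro of_nat_mono min_crossing_edges_le) auto
  also have "\<dots> = real (?D n) + ?g n"
    using le by (simp only: of_nat_add of_nat_diff)
  also have "real (?D n) \<le> real (n - 1 choose (k - 1)) / real ?s"
  proof -
    have "real (?D n) * real ?s \<le> real (n - 1 choose (k - 1))"
      using le unfolding of_nat_mult[symmetric] by (rule of_nat_mono)
    moreover have "real ?s > 0" using assms by simp
    ultimately show ?thesis by (simp add: pos_le_divide_eq)
  qed
  also have "\<dots> = real (n choose k) / real (r choose k) * (real r / real n)"
    using choose_absorption_ratio[of k r n] assms n by simp
  finally show "real (min_crossing_edges n k r)
    \<le> real (n choose k) / real (r choose k) * (real r / real n) + ?g n" by simp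
qed

end
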